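(* There exists an absolute numerical constant $C>0$ such that the following holds. Let $f:\mathbb{R}^d\to\mathbb{R}$ be $L$-smooth, $(L_0,L_1)$-smooth and convex, and suppose its infimum is attained, at $\mathbf{x}^\star\in\arg\min_{\mathbf{x}}f(\mathbf{x})$, with $f^\star=f(\mathbf{x}^\star)$. Let $c>0$, $0<\eta\le (L_0+cL_1)^{-1}$, $\mathbf{x}_0\in\mathbb{R}^d$, and let $\mathbf{x}_{t+1}=\mathbf{x}_t-\eta\,\mathrm{clip}_c(\nabla f(\mathbf{x}_t))$ for $t\ge 0$ be the iterates of clipped gradient descent with deterministic gradients. Then for every integer $T\ge 1$, $$f(\mathbf{x}_T)-f^\star\;\le\; C\left(\frac{R_0^2}{\eta T}+\frac{R_0^4L}{\eta^2T^2c^2}\right),\qquad R_0^2=\|\mathbf{x}_0-\mathbf{x}^\star\|^2.$$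
   Context: $\|\cdot\|$ is the Euclidean norm. $L$-smoothness: $f$ is differentiable and $\|\nabla f(\mathbf{x})-\nabla f(\mathbf{y})\|\le L\|\mathbf{x}-\mathbf{y}\|$ for all $\mathbf{x},\mathbf{y}\in\mathbb{R}^d$. $(L_0,L_1)$-smoothness, for constants $L_0,L_1\ge 0$: $f$ is differentiable and $\|\nabla f(\mathbf{x})-\nabla f(\mathbf{y})\|\le (L_0+L_1\|\nabla f(\mathbf{x})\|)\,\|\mathbf{x}-\mathbf{y}\|$ for all $\mathbf{x},\mathbf{y}\in\mathbb{R}^d$ with $\|\mathbf{x}-\mathbf{y}\|\le 1/L_1$ (with $1/L_1=+\infty$ if $L_1=0$). Convexity: $f(\mathbf{x})-f(\mathbf{y})\le\langle\nabla f(\mathbf{x}),\mathbf{x}-\mathbf{y}\rangle$ for all $\mathbf{x},\mathbf{y}\in\mathbb{R}^d$. Clipping operator: $\mathrm{clip}_c(\mathbf{u})=\min\big(1,\frac{c}{\|\mathbf{u}\|}\big)\mathbf{u}$ (with $\mathrm{clip}_c(0)=0$). *)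

theory Defs
  imports "HOL-Analysis.Analysis"
begin

text \<open>The constant of the theorem does not depend on the dimension \<open>d\<close>, so \<open>d\<close> has to be a term
  and not a type.  As in \<^theory>\<open>HOL-Analysis.Abstract_Euclidean_Space\<close>, the space
  of dimension \<open>d\<close> is the set of real sequences that vanish from index \<open>d\<close> on.  A function on it is
  a total function on sequences, of which only the values on this set are ever used.\<close>

abbreviation Rd :: "nat \<Rightarrow> (nat \<Rightarrow> real) set" where
  "Rd d \<equiv> topspace (Euclidean_space d)"

abbreviation enorm :: "nat \<Rightarrow> (nat \<Rightarrow> real) \<Rightarrow> real" where
  "enorm d x \<equiv> L2_set x {..<d}"

definition einner :: "nat \<Rightarrow> (nat \<Rightarrow> real) \<Rightarrow> (nat \<Rightarrow> real) \<Rightarrow> real" where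
  "einner d x y = (\<Sum>i<d. x i * y i)"

text \<open>Frechet differentiability with derivative \<open>h \<mapsto> \<langle>g, h\<rangle>\<close>, in the form of
  \<open>has_derivative_at_alt\<close>; lemma \<open>has_grad_iff_GDERIV\<close> below identifies it with the
  library's \<open>GDERIV\<close> on \<open>real ^ 'n\<close>.\<close>

definition has_grad :: "nat \<Rightarrow> ((nat \<Rightarrow> real) \<Rightarrow> real) \<Rightarrow> (nat \<Rightarrow> real) \<Rightarrow> (nat \<Rightarrow> real) \<Rightarrow> bool" where
  "has_grad d f g x \<longleftrightarrow> g \<in> Rd d \<and>
     (\<forall>e>0. \<exists>\<delta>>0. \<forall>y\<in>Rd d. enorm d (y - x) < \<delta> \<longrightarrow>
        \<bar>f y - f x - einner d g (y - x)\<bar> \<le> e * enorm d (y - x))"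

definition differentiable_Rd :: "nat \<Rightarrow> ((nat \<Rightarrow> real) \<Rightarrow> real) \<Rightarrow> bool" where
  "differentiable_Rd d f \<longleftrightarrow> (\<forall>x\<in>Rd d. \<exists>g. has_grad d f g x)"

definition grad :: "nat \<Rightarrow> ((nat \<Rightarrow> real) \<Rightarrow> real) \<Rightarrow> (nat \<Rightarrow> real) \<Rightarrow> (nat \<Rightarrow> real)" where
  "grad d f x = (THE g. has_grad d f g x)"

definition L_smooth :: "nat \<Rightarrow> real \<Rightarrow> ((nat \<Rightarrow> real) \<Rightarrow> real) \<Rightarrow> bool" where
  "L_smooth d L f \<longleftrightarrow> differentiable_Rd d f \<and>
     (\<forall>x\<in>Rd d. \<forall>y\<in>Rd d. enorm d (grad d f x - grad d f y) \<le> L * enorm d (x - y))"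

text \<open>The guard \<open>L1 \<noteq> 0\<close> implements \<open>1 / 0 = \<infinity>\<close>; in HOL, \<open>1 / 0 = 0\<close>.\<close>

definition L0_L1_smooth :: "nat \<Rightarrow> real \<Rightarrow> real \<Rightarrow> ((nat \<Rightarrow> real) \<Rightarrow> real) \<Rightarrow> bool" where
  "L0_L1_smooth d L0 L1 f \<longleftrightarrow> L0 \<ge> 0 \<and> L1 \<ge> 0 \<and> differentiable_Rd d f \<and>
     (\<forall>x\<in>Rd d. \<forall>y\<in>Rd d. (L1 \<noteq> 0 \<longrightarrow> enorm d (x - y) \<le> 1 / L1) \<longrightarrow>
        enorm d (grad d f x - grad d f y) \<le> (L0 + L1 * enorm d (grad d f x)) * enorm d (x - y))"

definition convex_Rd :: "nat \<Rightarrow> ((nat \<Rightarrow> real) \<Rightarrow> real) \<Rightarrow> bool" where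
  "convex_Rd d f \<longleftrightarrow>
     (\<forall>x\<in>Rd d. \<forall>y\<in>Rd d. f x - f y \<le> einner d (grad d f x) (x - y))"

text \<open>At \<open>u = 0\<close> the value is \<open>0\<close>, whatever \<open>c / 0\<close> is.\<close>

definition clip :: "nat \<Rightarrow> real \<Rightarrow> (nat \<Rightarrow> real) \<Rightarrow> (nat \<Rightarrow> real)" where
  "clip d c u = (\<lambda>i. min 1 (c / enorm d u) * u i)"

definition clipped_gd ::
  "nat \<Rightarrow> ((nat \<Rightarrow> real) \<Rightarrow> real) \<Rightarrow> real \<Rightarrow> real \<Rightarrow> (nat \<Rightarrow> nat \<Rightarrow> real) \<Rightarrow> bool" where
  "clipped_gd d f c \<eta> x \<longleftrightarrow> x 0 \<in> Rd d \<and>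
     (\<forall>t. x (Suc t) = (\<lambda>i. x t i - \<eta> * clip d c (grad d f (x t)) i))"

lemma enorm_sq: "(enorm d x)\<^sup>2 = einner d x x"
  by (simp add: L2_set_def einner_def sum_nonneg power2_eq_square)

lemma has_grad_unique:
  assumes x: "x \<in> Rd d" and g: "has_grad d f g x" and g': "has_grad d f g' x"
  shows "g = g'"
proof (rule ccontr)
  assume ne: "g \<noteq> g'"
  define u where "u = g - g'"
  have gR: "g \<in> Rd d" "g' \<in> Rd d" using g g' by (auto simp: has_grad_def)
  obtain i where "g i \<noteq> g' i" using ne by blast
  then have i: "i < d" "u i \<noteq> 0"
    using gR by (auto simp: u_def topspace_Euclidean_space intro: ccontr)
  have u0: "0 < enorm d u"
    using i by (auto simp: less_le L2_set_eq_0_iff)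
  define e where "e = enorm d u / 4"
  have e0: "e > 0" using u0 by (simp add: e_def)
  obtain r where r: "r > 0" "\<And>y. y \<in> Rd d \<Longrightarrow> enorm d (y - x) < r \<Longrightarrow>
      \<bar>f y - f x - einner d g (y - x)\<bar> \<le> e * enorm d (y - x)"
    using g e0 unfolding has_grad_def by metis
  obtain r' where r': "r' > 0" "\<And>y. y \<in> Rd d \<Longrightarrow> enorm d (y - x) < r' \<Longrightarrow>
      \<bar>f y - f x - einner d g' (y - x)\<bar> \<le> e * enorm d (y - x)"
    using g' e0 unfolding has_grad_def by metis
  define s where "s = min r r' / (2 * enorm d u)"
  have s0: "s > 0" using r(1) r'(1) u0 by (simp add: s_def)
  define y where "y = (\<lambda>i. x i + s * u i)"
  have yx: "y - x = (\<lambda>i. s * u i)" by (auto simp: y_def)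
  have yR: "y \<in> Rd d" using x gR by (auto simp: y_def u_def topspace_Euclidean_space)
  have n: "enorm d (y - x) = s * enorm d u"
    unfolding yx using s0 by (simp add: L2_set_right_distrib)
  have "s * enorm d u = min r r' / 2" using u0 by (simp add: s_def)
  then have lt: "enorm d (y - x) < r" "enorm d (y - x) < r'"
    using r(1) r'(1) by (auto simp: n)
  have "einner d g (y - x) - einner d g' (y - x) = s * (enorm d u)\<^sup>2"
    unfolding enorm_sq einner_def yx
    by (simp add: u_def sum_distrib_left sum_subtractf sum.distrib algebra_simps)
  then have "s * (enorm d u)\<^sup>2 \<le> 2 * e * (s * enorm d u)"
    using r(2)[OF yR lt(1)] r'(2)[OF yR lt(2)] unfolding n by linarith
  also have "\<dots> = s * (enorm d u)\<^sup>2 / 2"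
    by (simp add: e_def power2_eq_square)
  finally show False using s0 u0 by (simp add: zero_less_mult_iff)
qed

lemma grad_eq: "x \<in> Rd d \<Longrightarrow> has_grad d f g x \<Longrightarrow> grad d f x = g"
  unfolding grad_def by (rule the_equality) (auto intro: has_grad_unique)

lemma has_grad_grad: "differentiable_Rd d f \<Longrightarrow> x \<in> Rd d \<Longrightarrow> has_grad d f (grad d f x) x"
  unfolding differentiable_Rd_def using grad_eq by metis

lemma has_grad_iff_GDERIV:
  fixes F :: "real ^ 'n \<Rightarrow> real" and b :: "nat \<Rightarrow> 'n" and z w :: "real ^ 'n"
  defines "to_seq \<equiv> \<lambda>v :: real ^ 'n. \<lambda>i. if i < CARD('n) then v $ b i else 0"
  assumes b: "bij_betw b {..<CARD('n)} UNIV"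
    and fF: "\<And>v. f (to_seq v) = F v"
  shows "has_grad CARD('n) f (to_seq w) (to_seq z) \<longleftrightarrow> GDERIV F z :> w"
proof -
  have seqR: "to_seq v \<in> Rd CARD('n)" for v
    by (simp add: to_seq_def topspace_Euclidean_space)
  have surj: "\<exists>v. y = to_seq v" if "y \<in> Rd CARD('n)" for y
  proof
    show "y = to_seq (\<chi> k. y (inv_into {..<CARD('n)} b k))"
      using that b
      by (auto simp: to_seq_def topspace_Euclidean_space fun_eq_iff bij_betw_inv_into_left not_less)
  qed
  have diff: "to_seq v - to_seq v' = to_seq (v - v')" for v v'
    by (auto simp: to_seq_def)
  have inn: "einner CARD('n) (to_seq v) (to_seq v') = v \<bullet> v'" for v v'
    unfolding einner_def inner_vec_def
    by (subst sum.reindex_bij_betw[OF b, symmetric]) (simp add: to_seq_def)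
  have nrm: "enorm CARD('n) (to_seq v) = norm v" for v
    unfolding norm_eq_sqrt_inner inn[symmetric] enorm_sq[symmetric] by simp
  have ball: "(\<forall>y\<in>Rd CARD('n). P y) \<longleftrightarrow> (\<forall>v. P (to_seq v))" for P
    using surj seqR by metis
  show ?thesis
    unfolding has_grad_def gderiv_def has_derivative_at_alt ball diff inn nrm fF
    by (simp add: seqR bounded_linear_inner_left inner_commute)
qed

end

theory Submission
  imports Defs
begin

text \<open>Write \<open>\<Delta>\<^sub>t = f (x t) - f xs\<close>, \<open>G\<^sub>t = \<parallel>\<nabla>f (x t)\<parallel>\<close>, \<open>R\<^sub>t = \<parallel>x t - xs\<parallel>\<close>.  Local smoothness makes each
  step decrease \<open>f\<close> by at least \<open>\<eta> min(G\<^sub>t, c) G\<^sub>t / 2\<close>, which by convexity also makes \<open>R\<^sub>t\<close>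
  nonincreasing.  An unclipped step decreases \<open>R\<^sub>t\<^sup>2\<close> by \<open>2 \<eta> \<Delta>\<^sub>t\<^sub>+\<^sub>1\<close>.  A clipped step decreases \<open>\<Delta>\<^sub>t\<close> by
  \<open>\<eta> c G\<^sub>t / 2\<close>, and \<open>\<Delta>\<^sub>t \<le> G\<^sub>t R\<^sub>0\<close>, so it contracts \<open>\<Delta>\<^sub>t\<close> by the factor \<open>1 - q\<close> with
  \<open>q = \<eta> c / (2 R\<^sub>0)\<close>.  Either half of the first \<open>T\<close> steps are unclipped, which gives the first term of
  the rate, or half are clipped, and then \<open>\<Delta>\<^sub>T \<le> exp (- q T / 2) L R\<^sub>0\<^sup>2\<close>, which is dominated by the
  second term because \<open>exp (- u) \<le> 2 / u\<^sup>2\<close>.\<close>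

section \<open>Gradients on sequences\<close>

lemma einner_le_enorm: "einner d u v \<le> enorm d u * enorm d v"
proof -
  have "einner d u v \<le> (\<Sum>i<d. \<bar>u i\<bar> * \<bar>v i\<bar>)"
    unfolding einner_def by (intro sum_mono) (metis abs_ge_self abs_mult)
  also have "\<dots> \<le> enorm d u * enorm d v" by (rule L2_set_mult_ineq)
  finally show ?thesis .
qed

lemma enorm_scale: "enorm d (\<lambda>i. s * u i) = \<bar>s\<bar> * enorm d u"
  by (simp add: L2_set_def power_mult_distrib real_sqrt_mult flip: sum_distrib_left)

lemma einner_scale_right: "einner d u (\<lambda>i. s * v i) = s * einner d u v"
  by (simp add: einner_def sum_distrib_left algebra_simps)

lemma einner_diff_left: "einner d (u - v) w = einner d u w - einner d v w"
  by (simp add: einner_def sum_subtractf algebra_simps)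

lemma enorm_diff_scale_sq:
  "(enorm d (\<lambda>i. u i - s * v i))\<^sup>2 = (enorm d u)\<^sup>2 - 2 * s * einner d v u + s\<^sup>2 * (enorm d v)\<^sup>2"
  unfolding enorm_sq einner_def
  by (simp add: sum_distrib_left sum_subtractf sum.distrib algebra_simps power2_eq_square)

lemma Rd_affine: "u \<in> Rd d \<Longrightarrow> v \<in> Rd d \<Longrightarrow> (\<lambda>i. u i + s * v i) \<in> Rd d"
  by (simp add: topspace_Euclidean_space)

text \<open>Restriction to a line turns \<open>has_grad\<close> into an ordinary real derivative, so
  the one-variable monotonicity and extremum theorems become available.\<close>

lemma has_grad_line:
  assumes x: "x \<in> Rd d" and v: "v \<in> Rd d" and g: "has_grad d f g (\<lambda>i. x i + s * v i)"
  shows "((\<lambda>s. f (\<lambda>i. x i + s * v i)) has_real_derivative einner d g v) (at s)"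
  unfolding has_field_derivative_def has_derivative_at_alt
proof (intro conjI allI impI)
  show "bounded_linear ((*) (einner d g v))" by (rule bounded_linear_mult_right)
  fix e :: real assume "e > 0"
  define n where "n = enorm d v"
  have n: "n \<ge> 0" by (simp add: n_def)
  \<comment> \<open>Dividing by \<open>n + 1\<close> instead of \<open>n\<close> also covers
    \<open>v = 0\<close>.\<close>
  have "e / (n + 1) > 0" using \<open>e > 0\<close> n by simp
  then obtain r where r: "r > 0" "\<And>y. y \<in> Rd d \<Longrightarrow> enorm d (y - (\<lambda>i. x i + s * v i)) < r \<Longrightarrow>
      \<bar>f y - f (\<lambda>i. x i + s * v i) - einner d g (y - (\<lambda>i. x i + s * v i))\<bar>
        \<le> e / (n + 1) * enorm d (y - (\<lambda>i. x i + s * v i))"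
    using conjunct2[OF g[unfolded has_grad_def], rule_format, of "e / (n + 1)"] by blast
  show "\<exists>r>0. \<forall>t. norm (t - s) < r \<longrightarrow>
      norm (f (\<lambda>i. x i + t * v i) - f (\<lambda>i. x i + s * v i) - einner d g v * (t - s))
        \<le> e * norm (t - s)"
  proof (intro exI[of _ "r / (n + 1)"] conjI allI impI)
    show "r / (n + 1) > 0" using r(1) n by simp
    fix t assume t: "norm (t - s) < r / (n + 1)"
    have d: "(\<lambda>i. x i + t * v i) - (\<lambda>i. x i + s * v i) = (\<lambda>i. (t - s) * v i)"
      by (auto simp: algebra_simps)
    have "\<bar>t - s\<bar> * n \<le> \<bar>t - s\<bar> * (n + 1)" by (intro mult_left_mono) auto
    also have "\<dots> < r" using t n by (simp add: pos_less_divide_eq)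
    finally have lt: "\<bar>t - s\<bar> * n < r" .
    have "\<bar>f (\<lambda>i. x i + t * v i) - f (\<lambda>i. x i + s * v i) - (t - s) * einner d g v\<bar>
        \<le> e / (n + 1) * (\<bar>t - s\<bar> * n)"
      using r(2)[OF Rd_affine[OF x v, of t]] lt
      unfolding d enorm_scale einner_scale_right n_def by blast
    also have "\<dots> = (e * \<bar>t - s\<bar>) * (n / (n + 1))" by simp
    also have "\<dots> \<le> (e * \<bar>t - s\<bar>) * 1"
      using \<open>e > 0\<close> n by (intro mult_left_mono) auto
    finally show "norm (f (\<lambda>i. x i + t * v i) - f (\<lambda>i. x i + s * v i) - einner d g v * (t - s))
        \<le> e * norm (t - s)"
      by (simp add: mult.commute)
  qed
qed

text \<open>The bound \<open>M\<close> is required only on the segment from \<open>x\<close> to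
  \<open>x + v\<close>, because the smoothness applied later is local.\<close>

lemma descent_lemma:
  assumes f: "differentiable_Rd d f" and x: "x \<in> Rd d" and v: "v \<in> Rd d"
    and M: "\<And>s. 0 \<le> s \<Longrightarrow> s \<le> 1 \<Longrightarrow>
      enorm d (grad d f (\<lambda>i. x i + s * v i) - grad d f x) \<le> M * (s * enorm d v)"
  shows "f (\<lambda>i. x i + v i) \<le> f x + einner d (grad d f x) v + M / 2 * (enorm d v)\<^sup>2"
proof -
  define G where "G s = grad d f (\<lambda>i. x i + s * v i)" for s
  \<comment> \<open>\<open>h\<close> is \<open>f\<close> along the segment minus its quadratic upper
    model; the claim is \<open>h 1 \<le> h 0\<close>, and Cauchy-Schwarz makes the derivative
    nonpositive.\<close>
  define h where "h s = f (\<lambda>i. x i + s * v i) - s * einner d (grad d f x) v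
    - s\<^sup>2 * (M / 2 * (enorm d v)\<^sup>2)" for s
  have "(h has_real_derivative
      einner d (G s) v - einner d (grad d f x) v - s * (M * (enorm d v)\<^sup>2)) (at s)" for s
    unfolding h_def G_def
    by (rule derivative_eq_intros has_grad_line x v has_grad_grad f Rd_affine refl)+ simp
  moreover have "einner d (G s) v - einner d (grad d f x) v - s * (M * (enorm d v)\<^sup>2) \<le> 0"
    if s: "0 \<le> s" "s \<le> 1" for s
  proof -
    have "einner d (G s) v - einner d (grad d f x) v \<le> enorm d (G s - grad d f x) * enorm d v"
      using einner_le_enorm[of d "G s - grad d f x" v] by (simp add: einner_diff_left)
    also have "\<dots> \<le> M * (s * enorm d v) * enorm d v"
      using M[OF s] by (intro mult_right_mono) (auto simp: G_def)
    finally show ?thesis by (simp add: power2_eq_square mult_ac)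
  qed
  ultimately have "h 1 \<le> h 0"
    by (intro DERIV_nonpos_imp_nonincreasing[of 0 1 h]) (simp, metis)
  then show ?thesis by (simp add: h_def)
qed

text \<open>Fermat's theorem along the direction of the gradient itself, where the directional
  derivative is the squared gradient norm.\<close>

lemma enorm_grad_arg_min:
  assumes f: "differentiable_Rd d f" and m: "is_arg_min f (\<lambda>y. y \<in> Rd d) z"
  shows "enorm d (grad d f z) = 0"
proof -
  have z: "z \<in> Rd d" and min: "\<And>y. y \<in> Rd d \<Longrightarrow> f z \<le> f y"
    using m by (auto simp: is_arg_min_def not_less)
  have g: "grad d f z \<in> Rd d" using has_grad_grad[OF f z] by (simp add: has_grad_def)
  let ?h = "\<lambda>s. f (\<lambda>i. z i + s * grad d f z i)"
  have "(?h has_real_derivative einner d (grad d f z) (grad d f z)) (at 0)"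
    using has_grad_line[OF z g, of f "grad d f z" 0] has_grad_grad[OF f z] by simp
  then have "einner d (grad d f z) (grad d f z) = 0"
    by (rule DERIV_local_min[where d = 1]) (simp_all add: min[OF Rd_affine[OF z g]])
  then show ?thesis by (simp flip: enorm_sq)
qed

section \<open>The clipped iteration\<close>

text \<open>At norm zero \<open>c / 0 = 0\<close> gives \<open>clip\<close> the factor 0, while here
  the factor is 1; both sides vanish since \<open>u\<close> is then identically zero. This form
  keeps the factor positive.\<close>

lemma clip_eq:
  assumes "u \<in> Rd d" "c > 0"
  shows "clip d c u = (\<lambda>i. (if enorm d u \<le> c then 1 else c / enorm d u) * u i)"
proof (cases "enorm d u = 0")
  case True
  then have "u i = 0" for i
    using assms(1) by (cases "i < d") (auto simp: L2_set_eq_0_iff topspace_Euclidean_space)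
  then show ?thesis by (simp add: clip_def)
next
  case False
  then have "enorm d u > 0" by (simp add: less_le)
  then have "min 1 (c / enorm d u) = (if enorm d u \<le> c then 1 else c / enorm d u)"
    by (simp add: min_def)
  then show ?thesis unfolding clip_def by (simp only:)
qed

text \<open>The product form of the step size condition covers \<open>L0 + c * L1 = 0\<close>
  without a case split.\<close>

locale clipped_descent =
  fixes d :: nat and f :: "(nat \<Rightarrow> real) \<Rightarrow> real" and L0 L1 c \<eta> :: real
    and xs :: "nat \<Rightarrow> real" and x :: "nat \<Rightarrow> nat \<Rightarrow> real"
  assumes smooth: "L0_L1_smooth d L0 L1 f" and convex: "convex_Rd d f"
    and min: "is_arg_min f (\<lambda>y. y \<in> Rd d) xs"
    and c_pos: "c > 0" and eta_pos: "\<eta> > 0" and eta_le: "\<eta> * (L0 + c * L1) \<le> 1"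
    and gd: "clipped_gd d f c \<eta> x"
begin

section \<open>Quantities tracked along the iteration\<close>

definition G :: "nat \<Rightarrow> real" where "G t = enorm d (grad d f (x t))"

definition R :: "nat \<Rightarrow> real" where "R t = enorm d (x t - xs)"

definition gap :: "nat \<Rightarrow> real" where "gap t = f (x t) - f xs"

text \<open>The effective clipping factor: \<open>a t * G t\<close> equals
  \<open>min (G t) c\<close>.\<close>

definition a :: "nat \<Rightarrow> real" where "a t = (if G t \<le> c then 1 else c / G t)"

lemma L0: "L0 \<ge> 0" and L1: "L1 \<ge> 0" and diff: "differentiable_Rd d f"
  using smooth by (auto simp: L0_L1_smooth_def)

lemma xs: "xs \<in> Rd d"
  using min by (simp add: is_arg_min_def)

lemma grad_Rd: "y \<in> Rd d \<Longrightarrow> grad d f y \<in> Rd d"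
  using has_grad_grad[OF diff] by (simp add: has_grad_def)

lemma G_nonneg: "G t \<ge> 0" and R_nonneg: "R t \<ge> 0"
  by (simp_all add: G_def R_def)

lemma a_pos: "a t > 0"
  using c_pos by (auto simp: a_def)

lemma a_G: "a t * G t \<le> c"
  using c_pos by (auto simp: a_def)

lemma x_Rd: "x t \<in> Rd d"
proof (induction t)
  case 0
  then show ?case using gd by (simp add: clipped_gd_def)
next
  case (Suc t)
  then show ?case
    using gd grad_Rd[OF Suc] by (simp add: clipped_gd_def clip_def topspace_Euclidean_space)
qed

lemma x_Suc: "x (Suc t) = (\<lambda>i. x t i + (- (\<eta> * a t)) * grad d f (x t) i)"
  using gd by (simp add: clipped_gd_def clip_eq grad_Rd x_Rd c_pos a_def G_def fun_eq_iff)

lemma gap_nonneg: "gap t \<ge> 0"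
  using min x_Rd[of t] by (auto simp: gap_def is_arg_min_def not_less)

lemma gap_le_inner: "gap t \<le> einner d (grad d f (x t)) (x t - xs)"
  using convex x_Rd xs by (auto simp: gap_def convex_Rd_def)

lemma gap_le: "gap t \<le> G t * R t"
  using gap_le_inner einner_le_enorm order_trans unfolding G_def R_def by blast

section \<open>One-step estimates\<close>

lemma descent: "gap (Suc t) \<le> gap t - \<eta> * a t * (G t)\<^sup>2 / 2"
proof -
  define v where "v = (\<lambda>i. (- (\<eta> * a t)) * grad d f (x t) i)"
  define M where "M = L0 + L1 * G t"
  have v: "v \<in> Rd d" using grad_Rd[OF x_Rd] by (simp add: v_def topspace_Euclidean_space)
  have nv: "enorm d v = \<eta> * (a t * G t)"
    unfolding v_def enorm_scale using eta_pos a_pos[of t] by (simp add: G_def abs_mult)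
  \<comment> \<open>The step has length at most \<open>\<eta> * c\<close>, and
    \<open>\<eta> * c * L1 \<le> 1\<close>, so the whole segment stays within the radius of local
    smoothness.\<close>
  have small: "\<eta> * (a t * G t) \<le> 1 / L1" if "L1 \<noteq> 0"
  proof -
    have "L1 > 0" using L1 that by simp
    moreover have "\<eta> * (a t * G t) \<le> \<eta> * c" using a_G eta_pos by (intro mult_left_mono) auto
    moreover have "\<eta> * c * L1 \<le> 1" using eta_le eta_pos L0
      by (smt (verit) mult_nonneg_nonneg distrib_left mult.assoc)
    ultimately show ?thesis by (smt (verit) pos_le_divide_eq)
  qed
  have "f (\<lambda>i. x t i + v i) \<le> f (x t) + einner d (grad d f (x t)) v + M / 2 * (enorm d v)\<^sup>2"
  proof (rule descent_lemma[OF diff x_Rd v])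
    fix s :: real assume s: "0 \<le> s" "s \<le> 1"
    have n: "enorm d (x t - (\<lambda>i. x t i + s * v i)) = s * enorm d v"
    proof -
      have "x t - (\<lambda>i. x t i + s * v i) = (\<lambda>i. (- s) * v i)" by auto
      then show ?thesis using s by (simp only: enorm_scale) simp
    qed
    have "s * enorm d v \<le> 1 * enorm d v" using s by (intro mult_right_mono) auto
    then have "L1 \<noteq> 0 \<longrightarrow> enorm d (x t - (\<lambda>i. x t i + s * v i)) \<le> 1 / L1"
      using small unfolding n nv by auto
    then have "enorm d (grad d f (x t) - grad d f (\<lambda>i. x t i + s * v i)) \<le> M * (s * enorm d v)"
      using smooth x_Rd[of t] Rd_affine[OF x_Rd v, of t s]
      unfolding L0_L1_smooth_def M_def G_def n[symmetric] by blast
    moreover have "enorm d (grad d f (x t) - grad d f (\<lambda>i. x t i + s * v i)) =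
        enorm d (grad d f (\<lambda>i. x t i + s * v i) - grad d f (x t))"
      by (simp add: L2_set_def power2_commute)
    ultimately show "enorm d (grad d f (\<lambda>i. x t i + s * v i) - grad d f (x t))
        \<le> M * (s * enorm d v)" by simp
  qed
  moreover have "einner d (grad d f (x t)) v = - (\<eta> * a t * (G t)\<^sup>2)"
    unfolding v_def einner_scale_right by (simp add: G_def enorm_sq)
  moreover have "M / 2 * (enorm d v)\<^sup>2 \<le> \<eta> * a t * (G t)\<^sup>2 / 2"
  proof -
    \<comment> \<open>a clipped step has \<open>G t / c \<ge> 1\<close>, hence \<open>M \<le> (L0 + c * L1) / a t\<close>\<close>
    have "a t * M \<le> L0 + c * L1"
    proof (cases "G t \<le> c")
      case True
      then show ?thesis using L1 by (simp add: a_def M_def mult.commute[of c] mult_left_mono)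
    next
      case False
      then have "G t > 0" "c / G t \<le> 1" using c_pos by auto
      then have "c / G t * L0 \<le> L0" using L0 by (intro mult_left_le_one_le) (auto simp: c_pos less_imp_le)
      then show ?thesis using False \<open>G t > 0\<close> by (simp add: a_def M_def distrib_left)
    qed
    then have "\<eta> * (a t * M) \<le> 1"
      using eta_le eta_pos by (smt (verit) mult_left_mono)
    \<comment> \<open>The quadratic term thus costs at most half of the first-order decrease
      \<open>\<eta> * a t * (G t)\<^sup>2\<close>.\<close>
    then have "\<eta> * (a t * M) * (\<eta> * a t * (G t)\<^sup>2 / 2) \<le> 1 * (\<eta> * a t * (G t)\<^sup>2 / 2)"
      using eta_pos a_pos[of t] by (intro mult_right_mono) auto
    then show ?thesis unfolding nv by (simp add: power2_eq_square mult_ac)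
  qed
  moreover have "f (\<lambda>i. x t i + v i) = f (x (Suc t))" unfolding x_Suc v_def ..
  ultimately show ?thesis unfolding gap_def by linarith
qed

lemma gap_Suc_le: "gap (Suc t) \<le> gap t"
proof -
  have "\<eta> * a t * (G t)\<^sup>2 \<ge> 0" using eta_pos a_pos[of t] by simp
  then show ?thesis using descent[of t] by linarith
qed

text \<open>Expanding the square, convexity contributes \<open>- 2 * \<eta> * a t * gap t\<close>,
  and \<open>descent\<close> bounds the quadratic term by
  \<open>2 * \<eta> * a t * (gap t - gap (Suc t))\<close>; the sum leaves the gap after the
  step.\<close>

lemma R_Suc_sq: "(R (Suc t))\<^sup>2 + 2 * \<eta> * a t * gap (Suc t) \<le> (R t)\<^sup>2"
proof -
  have "(R (Suc t))\<^sup>2 = (R t)\<^sup>2 - 2 * (\<eta> * a t) * einner d (grad d f (x t)) (x t - xs)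
      + (\<eta> * a t)\<^sup>2 * (G t)\<^sup>2"
  proof -
    have "x (Suc t) - xs = (\<lambda>i. (x t - xs) i - (\<eta> * a t) * grad d f (x t) i)"
      unfolding x_Suc by auto
    then show ?thesis unfolding R_def G_def by (simp only: enorm_diff_scale_sq)
  qed
  moreover have p: "\<eta> * a t > 0" using eta_pos a_pos by simp
  moreover have "(\<eta> * a t) * gap t \<le> (\<eta> * a t) * einner d (grad d f (x t)) (x t - xs)"
    using p gap_le_inner by (intro mult_left_mono) auto
  moreover have "(\<eta> * a t) * (\<eta> * a t * (G t)\<^sup>2) \<le> (\<eta> * a t) * (2 * (gap t - gap (Suc t)))"
    using p descent[of t] by (intro mult_left_mono) auto
  ultimately show ?thesis by (simp add: power2_eq_square algebra_simps)
qed

section \<open>Accumulation over unclipped and clipped steps\<close>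

lemma R_le: "R t \<le> R 0"
proof (induction t)
  case (Suc t)
  have "2 * \<eta> * a t * gap (Suc t) \<ge> 0" using eta_pos a_pos[of t] gap_nonneg by simp
  then have "(R (Suc t))\<^sup>2 \<le> (R t)\<^sup>2" using R_Suc_sq[of t] by linarith
  then show ?case using R_nonneg Suc by (meson power2_le_imp_le order_trans)
qed simp

text \<open>Telescoping \<open>R_Suc_sq\<close>: unclipped steps have \<open>a t = 1\<close>,
  clipped ones contribute a nonnegative term that is dropped, and monotonicity replaces every gap by
  the last one.\<close>

lemma unclipped_bound: "(R n)\<^sup>2 + 2 * \<eta> * real (card {t\<in>{..<n}. G t \<le> c}) * gap n \<le> (R 0)\<^sup>2"
proof (induction n)
  case (Suc n)
  let ?U = "\<lambda>n. real (card {t\<in>{..<n}. G t \<le> c})"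
  have m: "2 * \<eta> * ?U n * gap (Suc n) \<le> 2 * \<eta> * ?U n * gap n"
    using eta_pos gap_Suc_le by (intro mult_left_mono) auto
  have U: "{t\<in>{..<Suc n}. G t \<le> c} =
      (if G n \<le> c then insert n {t\<in>{..<n}. G t \<le> c} else {t\<in>{..<n}. G t \<le> c})"
    by (auto simp: less_Suc_eq)
  show ?case
  proof (cases "G n \<le> c")
    case True
    then have "?U (Suc n) = ?U n + 1" unfolding U by simp
    then show ?thesis
      using m Suc R_Suc_sq[of n] True by (simp add: a_def algebra_simps)
  next
    case False
    then have "?U (Suc n) = ?U n" unfolding U by simp
    moreover have "2 * \<eta> * a n * gap (Suc n) \<ge> 0" using eta_pos a_pos[of n] gap_nonneg by simp
    ultimately show ?thesis using m Suc R_Suc_sq[of n] by simp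
  qed
qed simp

lemma clipped_bound:
  assumes R0: "R 0 > 0"
  shows "gap n \<le> exp (- (\<eta> * c / (2 * R 0) * real (card {t\<in>{..<n}. G t > c}))) * gap 0"
proof (induction n)
  case (Suc n)
  let ?K = "\<lambda>n. real (card {t\<in>{..<n}. G t > c})"
  let ?q = "\<eta> * c / (2 * R 0)"
  have K: "{t\<in>{..<Suc n}. G t > c} =
      (if G n > c then insert n {t\<in>{..<n}. G t > c} else {t\<in>{..<n}. G t > c})"
    by (auto simp: less_Suc_eq)
  show ?case
  proof (cases "G n > c")
    case True
    then have Suc_K: "?K (Suc n) = ?K n + 1" unfolding K by simp
    \<comment> \<open>Using \<open>R 0\<close> in place of \<open>R n\<close> makes the contraction
      rate the same for all clipped steps.\<close>
    have "gap n \<le> G n * R 0"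
      using gap_le R_le G_nonneg by (meson mult_left_mono order_trans)
    then have "?q * gap n \<le> ?q * (G n * R 0)"
      using eta_pos c_pos R0 by (intro mult_left_mono) auto
    also have "\<dots> = \<eta> * a n * (G n)\<^sup>2 / 2"
      using True c_pos R0 by (simp add: a_def power2_eq_square)
    finally have "gap (Suc n) \<le> (1 + (- ?q)) * gap n"
      using descent[of n] unfolding distrib_right by linarith
    also have "\<dots> \<le> exp (- ?q) * gap n"
      by (intro mult_right_mono exp_ge_add_one_self gap_nonneg)
    also have "\<dots> \<le> exp (- ?q) * (exp (- (?q * ?K n)) * gap 0)"
      using Suc by (intro mult_left_mono) auto
    also have "\<dots> = exp (- (?q * ?K (Suc n))) * gap 0"
      unfolding Suc_K by (simp add: distrib_left flip: exp_add)
    finally show ?thesis .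
  next
    case False
    then have "?K (Suc n) = ?K n" unfolding K by simp
    then show ?thesis using Suc gap_Suc_le[of n] by (metis order_trans)
  qed
qed simp

text \<open>The gradient vanishes at \<open>xs\<close>, so \<open>L\<close>-smoothness between
  \<open>x 0\<close> and \<open>xs\<close> gives \<open>G 0 \<le> L * R 0\<close>; convexity does
  the rest.\<close>

lemma gap_0_le:
  assumes "L_smooth d L f"
  shows "gap 0 \<le> L * (R 0)\<^sup>2"
proof -
  have z: "enorm d (grad d f xs) = 0" by (rule enorm_grad_arg_min[OF diff min])
  have "enorm d (grad d f (x 0) - grad d f xs) \<le> L * R 0"
    using assms x_Rd xs by (auto simp: L_smooth_def R_def)
  moreover have "enorm d (grad d f (x 0) - grad d f xs) = G 0"
    unfolding G_def using z by (intro L2_set_cong) (auto simp: L2_set_eq_0_iff)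
  ultimately have "G 0 * R 0 \<le> L * R 0 * R 0" using R_nonneg by (intro mult_right_mono) auto
  then show ?thesis using gap_le[of 0] by (simp add: power2_eq_square)
qed

section \<open>The rate, by majority of unclipped or clipped steps\<close>

theorem rate:
  assumes L: "L_smooth d L f" and T: "T \<ge> 1"
  shows "gap T \<le> 32 * ((R 0)\<^sup>2 / (\<eta> * real T) + (R 0) ^ 4 * L / (\<eta>\<^sup>2 * (real T)\<^sup>2 * c\<^sup>2))"
proof (cases "R 0 = 0")
  case True
  then have "R T = 0" using R_le[of T] R_nonneg[of T] by simp
  then show ?thesis using gap_le[of T] True by simp
next
  case False
  then have R0: "R 0 > 0" using R_nonneg[of 0] by simp
  \<comment> \<open>\<open>L_smooth\<close> does not state the sign of \<open>L\<close>; it follows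
    from the nonnegative initial gap once \<open>R 0 > 0\<close>.\<close>
  have "0 \<le> L * (R 0)\<^sup>2" using gap_0_le[OF L] gap_nonneg[of 0] by linarith
  then have L_nonneg: "L \<ge> 0" using R0 by (simp add: zero_le_mult_iff)
  define U where "U = real (card {t\<in>{..<T}. G t \<le> c})"
  define K where "K = real (card {t\<in>{..<T}. G t > c})"
  have T_pos: "real T > 0" using T by simp
  have "card ({t\<in>{..<T}. G t \<le> c} \<union> {t\<in>{..<T}. G t > c})
      = card {t\<in>{..<T}. G t \<le> c} + card {t\<in>{..<T}. G t > c}"
    by (intro card_Un_disjoint) auto
  moreover have "{t\<in>{..<T}. G t \<le> c} \<union> {t\<in>{..<T}. G t > c} = {..<T}" by auto
  ultimately have UK: "real T = U + K" unfolding U_def K_def by (metis card_lessThan of_nat_add)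
  let ?A = "(R 0)\<^sup>2 / (\<eta> * real T)"
  let ?B = "(R 0) ^ 4 * L / (\<eta>\<^sup>2 * (real T)\<^sup>2 * c\<^sup>2)"
  have A: "?A \<ge> 0" using eta_pos by simp
  have B: "?B \<ge> 0" using L_nonneg by simp
  show ?thesis
  proof (cases "U \<ge> K")
    case True
    \<comment> \<open>Here \<open>real T \<le> 2 * U\<close>, which absorbs the factor 2 of
      \<open>unclipped_bound\<close>.\<close>
    have "(\<eta> * gap T) * real T \<le> (\<eta> * gap T) * (2 * U)"
      using True UK eta_pos gap_nonneg by (intro mult_left_mono) auto
    also have "\<dots> \<le> (R 0)\<^sup>2"
      using unclipped_bound[of T] by (simp add: U_def mult_ac) (smt (verit) zero_le_power2)
    finally have "gap T \<le> ?A"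
      using eta_pos T_pos by (simp add: pos_le_divide_eq mult_ac)
    then show ?thesis using A B by simp
  next
    case False
    then have KT: "2 * K \<ge> real T" and K_pos: "K > 0" using UK T_pos by (auto simp: U_def)
    define u where "u = \<eta> * c / (2 * R 0) * K"
    have u_pos: "u > 0" using eta_pos c_pos R0 K_pos by (simp add: u_def)
    have "u\<^sup>2 / 2 \<le> exp u" using exp_lower_Taylor_quadratic[of u] u_pos by linarith
    then have "exp (- u) \<le> 2 / u\<^sup>2" using u_pos by (simp add: exp_minus field_simps)
    have "gap T \<le> exp (- u) * gap 0" using clipped_bound[OF R0, of T] by (simp add: u_def K_def)
    also have "\<dots> \<le> 2 / u\<^sup>2 * (L * (R 0)\<^sup>2)"
      using \<open>exp (- u) \<le> 2 / u\<^sup>2\<close> gap_0_le[OF L] gap_nonneg by (intro mult_mono) auto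
    \<comment> \<open>The constant 32 is 8 from \<open>2 / u\<^sup>2\<close> with
      \<open>u = \<eta> * c * K / (2 * R 0)\<close>, times 4 from writing \<open>K\<close> through
      \<open>2 * K\<close>, which is at least \<open>real T\<close>.\<close>
    also have "\<dots> = 32 * ((R 0) ^ 4 * L) / (\<eta>\<^sup>2 * (2 * K)\<^sup>2 * c\<^sup>2)"
      using R0 by (simp add: u_def field_simps power2_eq_square power4_eq_xxxx)
    also have "\<dots> \<le> 32 * ((R 0) ^ 4 * L) / (\<eta>\<^sup>2 * (real T)\<^sup>2 * c\<^sup>2)"
      using KT T_pos L_nonneg eta_pos c_pos
      by (intro divide_left_mono mult_left_mono mult_right_mono power_mono mult_pos_pos) auto
    finally have "gap T \<le> 32 * ?B" by simp
    then show ?thesis using A by simp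
  qed
qed

end

theorem theorem2p3:
  shows "\<exists>C::real. C > 0 \<and>
    (\<forall>(d::nat) (f :: (nat \<Rightarrow> real) \<Rightarrow> real) (L::real) (L0::real) (L1::real) (xs :: nat \<Rightarrow> real)
      (c::real) (\<eta>::real) (x :: nat \<Rightarrow> nat \<Rightarrow> real).
      L_smooth d L f \<longrightarrow> L0_L1_smooth d L0 L1 f \<longrightarrow> convex_Rd d f \<longrightarrow>
      is_arg_min f (\<lambda>y. y \<in> Rd d) xs \<longrightarrow>
      c > 0 \<longrightarrow>
      0 < \<eta> \<longrightarrow> (L0 + c * L1 \<noteq> 0 \<longrightarrow> \<eta> \<le> inverse (L0 + c * L1)) \<longrightarrow>
      clipped_gd d f c \<eta> x \<longrightarrow>
      (\<forall>T::nat. T \<ge> 1 \<longrightarrow>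
        f (x T) - f xs \<le>
          C * ((enorm d (x 0 - xs))\<^sup>2 / (\<eta> * real T)
             + (enorm d (x 0 - xs)) ^ 4 * L / (\<eta>\<^sup>2 * (real T)\<^sup>2 * c\<^sup>2))))"
proof (intro exI[of _ "32::real"] conjI allI impI)
  fix d f L L0 L1 xs c \<eta> x and T :: nat
  assume L: "L_smooth d L f" and smooth: "L0_L1_smooth d L0 L1 f" and "convex_Rd d f"
    and "is_arg_min f (\<lambda>y. y \<in> Rd d) xs" and c: "c > 0" and "0 < \<eta>"
    and \<eta>: "L0 + c * L1 \<noteq> 0 \<longrightarrow> \<eta> \<le> inverse (L0 + c * L1)"
    and "clipped_gd d f c \<eta> x" and T: "T \<ge> 1"
  have "L0 + c * L1 \<ge> 0" using smooth c by (simp add: L0_L1_smooth_def)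
  then have step: "\<eta> * (L0 + c * L1) \<le> 1"
    using \<eta> by (cases "L0 + c * L1 = 0") (simp_all add: field_simps)
  interpret clipped_descent d f L0 L1 c \<eta> xs x
    by unfold_locales fact+
  show "f (x T) - f xs \<le> 32 * ((enorm d (x 0 - xs))\<^sup>2 / (\<eta> * real T)
      + (enorm d (x 0 - xs)) ^ 4 * L / (\<eta>\<^sup>2 * (real T)\<^sup>2 * c\<^sup>2))"
    using rate[OF L T] by (simp add: gap_def R_def)
qed simp

end
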